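(* For every integer $n\ge 1$: (i) $|I_n(4321,132)|=|I_n(4321,213)|=1+\lfloor\frac{n}{2}\rfloor\lceil\frac{n}{2}\rceil$; (ii) $|I_n(4321,321)|=\binom{n}{\lfloor n/2\rfloor}$; (iii) $I_n(4321,312)=I_n(4321,231)$ and $|I_n(4321,312)|=t_{n+2}$, where $(t_n)_{n\ge0}$ is the sequence of Tribonacci numbers defined by $t_0=0$, $t_1=0$, $t_2=1$ and $t_{n+3}=t_{n+2}+t_{n+1}+t_n$.
   Context: $I_n$ is the set of involutions in the symmetric group $S_n$. A permutation $\sigma\in S_n$ contains the pattern $\pi\in S_k$ if there are $1\le i_1<\dots<i_k\le n$ such that $(\sigma(i_1),\dots,\sigma(i_k))$ is order-isomorphic to $\pi$; otherwise $\sigma$ avoids $\pi$. $I_n(\pi_1,\pi_2)$ denotes the set of elements of $I_n$ that avoid both $\pi_1$ and $\pi_2$. *)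

theory Defs
  imports Complex_Main "HOL-Combinatorics.Permutations"
begin

text \<open>
  Elements of the symmetric group on \<open>{1..n}\<close> are functions satisfying
  \<^term>\<open>\<sigma> permutes {1..n}\<close>, hence fixing everything outside \<open>{1..n}\<close>.
  A pattern of length \<open>k\<close> is given by its one-line notation, a list of length \<open>k\<close>;
  e.g. \<open>[3, 1, 2]\<close> is the pattern 312.
\<close>

definition involutions :: "nat \<Rightarrow> (nat \<Rightarrow> nat) set" where
  "involutions n = {\<sigma>. \<sigma> permutes {1..n} \<and> \<sigma> \<circ> \<sigma> = id}"

text \<open>
  The function \<open>i\<close> is the increasing sequence of positions of an occurrence of the pattern,
  indexed from 0 to match list indexing.
\<close>

definition contains_pattern :: "nat \<Rightarrow> (nat \<Rightarrow> nat) \<Rightarrow> nat list \<Rightarrow> bool" where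
  "contains_pattern n \<sigma> \<pi> \<longleftrightarrow>
     (\<exists>i :: nat \<Rightarrow> nat.
        strict_mono_on {..<length \<pi>} i \<and>
        i ` {..<length \<pi>} \<subseteq> {1..n} \<and>
        (\<forall>a < length \<pi>. \<forall>b < length \<pi>. \<sigma> (i a) < \<sigma> (i b) \<longleftrightarrow> \<pi> ! a < \<pi> ! b))"

definition involutions_avoiding :: "nat \<Rightarrow> nat list \<Rightarrow> nat list \<Rightarrow> (nat \<Rightarrow> nat) set" where
  "involutions_avoiding n \<pi>\<^sub>1 \<pi>\<^sub>2 =
     {\<sigma> \<in> involutions n. \<not> contains_pattern n \<sigma> \<pi>\<^sub>1 \<and> \<not> contains_pattern n \<sigma> \<pi>\<^sub>2}"

fun tribonacci :: "nat \<Rightarrow> nat" where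
  "tribonacci 0 = 0"
| "tribonacci (Suc 0) = 0"
| "tribonacci (Suc (Suc 0)) = 1"
| "tribonacci (Suc (Suc (Suc n))) =
     tribonacci (Suc (Suc n)) + tribonacci (Suc n) + tribonacci n"

end

theory Submission
  imports Defs "HOL-Library.Infinite_Set"
begin

text \<open>
  Each family is described by a normal form that can be counted.

  For 4321 and 132, an involution either fixes \<open>n\<close> or is completely determined by \<open>j = \<sigma> n\<close>:
  avoiding 132 puts the \<open>j\<close> largest values on the first \<open>j\<close> positions, and avoiding 4321 then leaves
  only the permutation exchanging the first and the last \<open>j\<close> points in order
  (\<open>moving_last_point_imp_block_swap\<close>). As \<open>j\<close> ranges over \<open>1 \<le> j \<le> n / 2\<close>, passing from
  \<open>n - 1\<close> to \<open>n\<close> adds \<open>\<lfloor>n / 2\<rfloor>\<close> involutions. Turning the permutation diagram by 180 degrees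
  exchanges 132 with 213 and gives the other count.

  A permutation containing 4321 contains 321, so the second family consists of the involutions avoiding
  321. Draw an involution as a set of arcs joining the points that it exchanges. It avoids 321 if and only
  if no arc is nested in another and no fixed point lies under an arc. An arc diagram without
  nesting is determined by the sets of left and of right ends of its arcs
  (\<open>inj_on_excedances_deficiencies\<close>, \<open>arc_profile_realized\<close>). Reading left ends as up steps, right
  ends as down steps and fixed points as level steps gives the nonnegative lattice paths from 0 to 0
  whose level steps all lie at height 0. Removing the last step yields a recursion for the number
  of such paths ending at height \<open>h\<close>, which is solved by \<open>n choose \<lfloor>(n - h) / 2\<rfloor>\<close>
  (\<open>card_arc_profiles\<close>).

  Since 231 is the inverse of 312, an involution contains both or neither. An involution avoiding 312
  reverses the interval from \<open>\<sigma> n\<close> to \<open>n\<close>, and avoiding 4321 limits this interval to one, two or three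
  points (\<open>remove_last_layer\<close>); the rest is an arbitrary member of a smaller family
  (\<open>append_layer\<close>). Sorting by the length of this last interval gives the Tribonacci recursion.
\<close>

section \<open>Occurrences as tuples of positions\<close>

text \<open>
  Every argument below names the positions of an occurrence one by one, so the
  occurrences quantified as functions on indices are turned into tuples of positions.
  The six comparisons cannot be reduced to a single chain before the entries
  of the pattern are known.
\<close>

lemma contains_pattern_length3:
  "contains_pattern n \<sigma> [p, q, r] \<longleftrightarrow>
     (\<exists>a b c. 1 \<le> a \<and> a < b \<and> b < c \<and> c \<le> n \<and>
        (\<sigma> a < \<sigma> b \<longleftrightarrow> p < q) \<and> (\<sigma> b < \<sigma> a \<longleftrightarrow> q < p) \<and>
        (\<sigma> a < \<sigma> c \<longleftrightarrow> p < r) \<and> (\<sigma> c < \<sigma> a \<longleftrightarrow> r < p) \<and>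
        (\<sigma> b < \<sigma> c \<longleftrightarrow> q < r) \<and> (\<sigma> c < \<sigma> b \<longleftrightarrow> r < q))"
  (is "?L \<longleftrightarrow> ?R")
proof
  assume ?L
  then obtain i where i: "strict_mono_on {..<3} i" "i ` {..<3} \<subseteq> {1..n}"
      "\<forall>a<3. \<forall>b<3. \<sigma> (i a) < \<sigma> (i b) \<longleftrightarrow> [p, q, r] ! a < [p, q, r] ! b"
    by (auto simp: contains_pattern_def eval_nat_numeral)
  have "1 \<le> i 0" "i 0 < i 1" "i 1 < i 2" "i 2 \<le> n"
    using i(1,2) by (auto simp: strict_mono_on_def image_subset_iff)
  moreover have "\<sigma> (i s) < \<sigma> (i t) \<longleftrightarrow> [p, q, r] ! s < [p, q, r] ! t" if "s < 3" "t < 3" for s t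
    using i(3) that by blast
  from this[of 0 1] this[of 1 0] this[of 0 2] this[of 2 0] this[of 1 2] this[of 2 1]
  have "\<sigma> (i 0) < \<sigma> (i 1) \<longleftrightarrow> p < q" "\<sigma> (i 1) < \<sigma> (i 0) \<longleftrightarrow> q < p"
       "\<sigma> (i 0) < \<sigma> (i 2) \<longleftrightarrow> p < r" "\<sigma> (i 2) < \<sigma> (i 0) \<longleftrightarrow> r < p"
       "\<sigma> (i 1) < \<sigma> (i 2) \<longleftrightarrow> q < r" "\<sigma> (i 2) < \<sigma> (i 1) \<longleftrightarrow> r < q"
    by simp_all
  ultimately show ?R
    by blast
next
  assume ?R
  then obtain a b c where "1 \<le> a" "a < b" "b < c" "c \<le> n" and
        "\<sigma> a < \<sigma> b \<longleftrightarrow> p < q" "\<sigma> b < \<sigma> a \<longleftrightarrow> q < p"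
        "\<sigma> a < \<sigma> c \<longleftrightarrow> p < r" "\<sigma> c < \<sigma> a \<longleftrightarrow> r < p"
        "\<sigma> b < \<sigma> c \<longleftrightarrow> q < r" "\<sigma> c < \<sigma> b \<longleftrightarrow> r < q"
    by blast
  note occ = this
  define i where "i k = (if k = 0 then a else if k = 1 then b else c)" for k :: nat
  have i_simps: "i 0 = a" "i (Suc 0) = b" "i (Suc (Suc 0)) = c"
    by (simp_all add: i_def)
  show ?L
    unfolding contains_pattern_def
  proof (intro exI[of _ i] conjI)
    show "strict_mono_on {..<length [p, q, r]} i"
      using occ(2,3) by (auto simp: strict_mono_on_def i_def)
    show "i ` {..<length [p, q, r]} \<subseteq> {1..n}"
      using occ(1-4) by (auto simp: i_def)
    show "\<forall>r'<length [p, q, r]. \<forall>s<length [p, q, r].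
            \<sigma> (i r') < \<sigma> (i s) \<longleftrightarrow> [p, q, r] ! r' < [p, q, r] ! s"
      unfolding list.size All_less_Suc add_0_right add_Suc_right
      by (simp only: i_simps nth_Cons_0 nth_Cons_Suc occ less_irrefl simp_thms not_less_zero)
  qed
qed

lemma contains_4321_iff:
  "contains_pattern n \<sigma> [4, 3, 2, 1] \<longleftrightarrow>
     (\<exists>a b c d. 1 \<le> a \<and> a < b \<and> b < c \<and> c < d \<and> d \<le> n \<and>
        \<sigma> d < \<sigma> c \<and> \<sigma> c < \<sigma> b \<and> \<sigma> b < \<sigma> a)"
  (is "?L \<longleftrightarrow> ?R")
proof
  assume ?L
  then obtain i where i: "strict_mono_on {..<4} i" "i ` {..<4} \<subseteq> {1..n}"
      "\<forall>a<4. \<forall>b<4. \<sigma> (i a) < \<sigma> (i b) \<longleftrightarrow> [4, 3, 2, 1::nat] ! a < [4, 3, 2, 1] ! b"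
    by (auto simp: contains_pattern_def eval_nat_numeral)
  have "1 \<le> i 0" "i 0 < i 1" "i 1 < i 2" "i 2 < i 3" "i 3 \<le> n"
    using i(1,2) by (auto simp: strict_mono_on_def image_subset_iff)
  moreover have "\<sigma> (i 3) < \<sigma> (i 2)" "\<sigma> (i 2) < \<sigma> (i 1)" "\<sigma> (i 1) < \<sigma> (i 0)"
    using i(3) by auto
  ultimately show ?R
    by blast
next
  assume ?R
  then obtain a b c d where "1 \<le> a" "a < b" "b < c" "c < d" "d \<le> n"
        "\<sigma> d < \<sigma> c" "\<sigma> c < \<sigma> b" "\<sigma> b < \<sigma> a"
    by blast
  note occ = this
  define i where "i k = (if k = 0 then a else if k = 1 then b else if k = 2 then c else d)"
    for k :: nat
  have i_simps: "i 0 = a" "i (Suc 0) = b" "i (Suc (Suc 0)) = c" "i (Suc (Suc (Suc 0))) = d"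
    by (simp_all add: i_def)
  have descending: "\<sigma> d < \<sigma> a" "\<sigma> c < \<sigma> a" "\<sigma> d < \<sigma> b"
    using occ(6-8) by linarith+
  show ?L
    unfolding contains_pattern_def
  proof (intro exI[of _ i] conjI)
    show "strict_mono_on {..<length [4, 3, 2, 1 :: nat]} i"
      using occ(2-4) by (auto simp: strict_mono_on_def i_def)
    show "i ` {..<length [4, 3, 2, 1 :: nat]} \<subseteq> {1..n}"
      using occ(1-5) by (auto simp: i_def)
    show "\<forall>r<length [4, 3, 2, 1 :: nat]. \<forall>s<length [4, 3, 2, 1 :: nat].
            \<sigma> (i r) < \<sigma> (i s) \<longleftrightarrow> [4, 3, 2, 1 :: nat] ! r < [4, 3, 2, 1] ! s"
      unfolding list.size All_less_Suc add_0_right add_Suc_right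
      by (simp add: i_simps occ descending less_imp_le not_less)
  qed
qed

lemma contains_321_iff:
  "contains_pattern n \<sigma> [3, 2, 1] \<longleftrightarrow>
     (\<exists>a b c. 1 \<le> a \<and> a < b \<and> b < c \<and> c \<le> n \<and> \<sigma> c < \<sigma> b \<and> \<sigma> b < \<sigma> a)"
  unfolding contains_pattern_length3 by (intro ex_cong1) auto

lemma contains_132_iff:
  "contains_pattern n \<sigma> [1, 3, 2] \<longleftrightarrow>
     (\<exists>a b c. 1 \<le> a \<and> a < b \<and> b < c \<and> c \<le> n \<and> \<sigma> a < \<sigma> c \<and> \<sigma> c < \<sigma> b)"
  unfolding contains_pattern_length3 by (intro ex_cong1) auto

lemma contains_213_iff:
  "contains_pattern n \<sigma> [2, 1, 3] \<longleftrightarrow>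
     (\<exists>a b c. 1 \<le> a \<and> a < b \<and> b < c \<and> c \<le> n \<and> \<sigma> b < \<sigma> a \<and> \<sigma> a < \<sigma> c)"
  unfolding contains_pattern_length3 by (intro ex_cong1) auto

lemma contains_312_iff:
  "contains_pattern n \<sigma> [3, 1, 2] \<longleftrightarrow>
     (\<exists>a b c. 1 \<le> a \<and> a < b \<and> b < c \<and> c \<le> n \<and> \<sigma> b < \<sigma> c \<and> \<sigma> c < \<sigma> a)"
  unfolding contains_pattern_length3 by (intro ex_cong1) auto

lemma contains_231_iff:
  "contains_pattern n \<sigma> [2, 3, 1] \<longleftrightarrow>
     (\<exists>a b c. 1 \<le> a \<and> a < b \<and> b < c \<and> c \<le> n \<and> \<sigma> c < \<sigma> a \<and> \<sigma> a < \<sigma> b)"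
  unfolding contains_pattern_length3 by (intro ex_cong1) auto

section \<open>Involutions of an initial interval\<close>

lemma involutionsD:
  assumes "\<sigma> \<in> involutions n"
  shows "\<sigma> permutes {1..n}" "\<sigma> (\<sigma> i) = i"
  using assms by (auto simp: involutions_def fun_eq_iff)

lemma permutes_if_self_inverse:
  assumes "\<And>i. \<sigma> (\<sigma> i) = i" "\<And>i. i \<notin> S \<Longrightarrow> \<sigma> i = i"
  shows "\<sigma> permutes S"
  unfolding permutes_def using assms by metis

lemma involutionsI:
  assumes "\<And>i. \<sigma> (\<sigma> i) = i" "\<And>i. i \<notin> {1..n} \<Longrightarrow> \<sigma> i = i"
  shows "\<sigma> \<in> involutions n"
  using assms permutes_if_self_inverse[of \<sigma> "{1..n}"] by (auto simp: involutions_def fun_eq_iff)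

lemma involution_mem_iff:
  assumes "\<sigma> \<in> involutions n"
  shows "1 \<le> \<sigma> i \<and> \<sigma> i \<le> n \<longleftrightarrow> 1 \<le> i \<and> i \<le> n"
  using permutes_in_image[OF involutionsD(1)[OF assms], of i] by simp

lemma involution_outside:
  assumes "\<sigma> \<in> involutions n" "\<not> (1 \<le> i \<and> i \<le> n)"
  shows "\<sigma> i = i"
  using permutes_not_in[OF involutionsD(1)[OF assms(1)], of i] assms(2) by simp

lemma involution_eq_iff:
  assumes "\<sigma> \<in> involutions n"
  shows "\<sigma> i = \<sigma> k \<longleftrightarrow> i = k"
  using involutionsD(2)[OF assms] by metis

lemma finite_involutions_avoiding: "finite (involutions_avoiding n \<pi> \<rho>)"
proof (rule finite_subset)
  show "involutions_avoiding n \<pi> \<rho> \<subseteq> {\<sigma>. \<sigma> permutes {1..n}}"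
    by (auto simp: involutions_avoiding_def involutions_def)
qed (simp add: finite_permutations)

lemma involutions_0: "involutions 0 = {id}"
  by (auto simp: involutions_def)

section \<open>Avoiding 4321 and 132, or 4321 and 213\<close>

text \<open>
  For \<open>2 j \<le> n\<close> this exchanges the first \<open>j\<close> points with the last \<open>j\<close> points,
  keeping each block in order, and fixes everything in between.
\<close>

definition block_swap :: "nat \<Rightarrow> nat \<Rightarrow> nat \<Rightarrow> nat" where
  "block_swap n j i =
     (if 1 \<le> i \<and> i \<le> j then n - j + i else if n - j < i \<and> i \<le> n then i - (n - j) else i)"

text \<open>
  The graph consists of three increasing runs: a high one on the first block, a middle one,
  and a low one on the last block. Every position in an earlier run has a larger value than
  every position in a later run, so values can only rise inside a run.
\<close>

lemma block_swap_avoids_4321_132: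
  assumes "2 * j \<le> n"
  shows "block_swap n j \<in> involutions_avoiding n [4, 3, 2, 1] [1, 3, 2]"
proof -
  let ?\<sigma> = "block_swap n j"
  have low: "?\<sigma> i = n - j + i" if "1 \<le> i" "i \<le> j" for i
    using that by (simp add: block_swap_def)
  have mid: "?\<sigma> i = i" if "j < i" "i \<le> n - j" for i
    using that by (simp add: block_swap_def)
  have high: "?\<sigma> i = i - (n - j)" if "n - j < i" "i \<le> n" for i
    using that assms by (simp add: block_swap_def)
  have "?\<sigma> \<in> involutions n"
    using assms by (intro involutionsI) (auto simp: block_swap_def)
  moreover have "\<not> contains_pattern n ?\<sigma> [1, 3, 2]"
  proof
    assume "contains_pattern n ?\<sigma> [1, 3, 2]"
    then obtain a b c where abc: "1 \<le> a" "a < b" "b < c" "c \<le> n"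
        "?\<sigma> a < ?\<sigma> c" "?\<sigma> c < ?\<sigma> b"
      unfolding contains_132_iff by blast
    consider "c \<le> j" | "a \<le> j" "j < c" | "j < a" "c \<le> n - j"
      | "j < a" "n - j < c" "a \<le> n - j" | "n - j < a" "j < a"
      by linarith
    then show False
    proof cases
      case 1
      then show False using abc low[of b] low[of c] by simp
    next
      case 2
      then show False using abc low[of a] mid[of c] high[of c] assms
        by (cases "c \<le> n - j") simp_all
    next
      case 3
      then show False using abc mid[of b] mid[of c] by simp
    next
      case 4
      then show False using abc mid[of a] high[of c] assms by simp
    next
      case 5
      then show False using abc high[of b] high[of c] by simp
    qed
  qed
  moreover have "\<not> contains_pattern n ?\<sigma> [4, 3, 2, 1]"
  proof
    assume "contains_pattern n ?\<sigma> [4, 3, 2, 1]"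
    then obtain a b c d where abcd: "1 \<le> a" "a < b" "b < c" "c < d" "d \<le> n"
        "?\<sigma> d < ?\<sigma> c" "?\<sigma> c < ?\<sigma> b" "?\<sigma> b < ?\<sigma> a"
      unfolding contains_4321_iff by blast
    \<comment> \<open>The permutation increases on each of its three blocks, so four positions cannot descend.\<close>
    have incr: "(x \<le> j \<and> j < y) \<or> (x \<le> n - j \<and> n - j < y)"
      if xy: "1 \<le> x" "x < y" "y \<le> n" "?\<sigma> y < ?\<sigma> x" for x y
    proof (rule ccontr)
      assume "\<not> ?thesis"
      then consider "y \<le> j" | "j < x" "y \<le> n - j" | "n - j < x"
        by linarith
      then show False
        using xy low[of x] low[of y] mid[of x] mid[of y] high[of x] high[of y] by cases simp_all
    qed
    show False
      using incr[of a b] incr[of b c] incr[of c d] abcd by auto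
  qed
  ultimately show ?thesis
    by (simp add: involutions_avoiding_def)
qed

lemma block_swap_last: "1 \<le> j \<Longrightarrow> 2 * j \<le> n \<Longrightarrow> block_swap n j n = j"
  by (simp add: block_swap_def)

text \<open>
  If \<open>\<sigma> n = j < n\<close>, then \<open>n\<close> is the value at position \<open>j\<close>, and avoiding 132 forces every value
  before position \<open>j\<close> to exceed every value after it. Counting values shows that the first \<open>j\<close>
  positions carry the \<open>j\<close> largest values; in particular these are disjoint from the first \<open>j\<close>
  points, because \<open>j\<close> itself is a value after position \<open>j\<close>. A descent inside the first block
  would be mirrored by a descent in the last block, and a descent in the middle would lie between
  the value \<open>n\<close> at position \<open>j\<close> and the value \<open>j\<close> at position \<open>n\<close>; both give a 4321.
\<close>

lemma moving_last_point_imp_block_swap: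
  assumes \<sigma>: "\<sigma> \<in> involutions_avoiding n [4, 3, 2, 1] [1, 3, 2]"
    and n: "1 \<le> n" and moved: "\<sigma> n \<noteq> n"
  defines "j \<equiv> \<sigma> n"
  shows "1 \<le> j" "2 * j \<le> n" "\<sigma> = block_swap n j"
proof -
  have inv: "\<sigma> \<in> involutions n"
    and no4321: "\<not> contains_pattern n \<sigma> [4, 3, 2, 1]"
    and no132: "\<not> contains_pattern n \<sigma> [1, 3, 2]"
    using \<sigma> by (auto simp: involutions_avoiding_def)
  note inj = involution_eq_iff[OF inv] and self = involutionsD(2)[OF inv]
  have mem: "1 \<le> \<sigma> i \<and> \<sigma> i \<le> n" if "1 \<le> i" "i \<le> n" for i
    using involution_mem_iff[OF inv, of i] that by auto
  have \<sigma>n: "\<sigma> n = j" and \<sigma>j: "\<sigma> j = n"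
    using self by (auto simp: j_def)
  show j1: "1 \<le> j"
    using mem[of n] n by (simp add: j_def)
  have jn: "j < n"
    using mem[of n] n moved by (simp add: j_def)
  \<comment> \<open>Values are located by counting: a set of positions cannot have
      more elements than a finite set containing its values.\<close>
  have squeeze: "card A \<le> card B" if "\<sigma> ` A \<subseteq> B" "finite B" for A B
    using card_inj_on_le[of \<sigma> A B] inj that by (auto simp: inj_on_def)
  have fall: "\<sigma> k < \<sigma> i" if "1 \<le> i" "i \<le> j" "j < k" "k \<le> n" for i k
  proof (rule ccontr)
    assume "\<not> \<sigma> k < \<sigma> i"
    then have lt: "\<sigma> i < \<sigma> k"
      using inj[of i k] that by force
    have "\<sigma> k < n"
      using mem[of k] inj[of k j] \<sigma>j that by force
    then have "i < j"
      using lt that \<sigma>j by (metis le_neq_implies_less less_asym)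
    then have "contains_pattern n \<sigma> [1, 3, 2]"
      unfolding contains_132_iff using that lt \<sigma>j \<open>\<sigma> k < n\<close>
      by (intro exI[of _ i] exI[of _ j] exI[of _ k]) simp
    with no132 show False
      by simp
  qed
  have right: "\<sigma> k \<le> n - j" if "j < k" "k \<le> n" for k
  proof -
    have "card {1..j} \<le> card {\<sigma> k<..n}"
      using fall[of _ k] mem that jn by (intro squeeze) auto
    then show ?thesis
      using mem[of k] that by simp arith
  qed
  show j2: "2 * j \<le> n"
    using right[of n] jn \<sigma>n by simp
  have left: "n - j < \<sigma> i" if "1 \<le> i" "i \<le> j" for i
  proof -
    have "card {j<..n} \<le> card {1..<\<sigma> i}"
      using fall[of i] mem that by (intro squeeze) auto
    then show ?thesis
      using mem[of i] that jn by simp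
  qed
  have left_mono: "\<sigma> a < \<sigma> b" if "1 \<le> a" "a < b" "b \<le> j" for a b
  proof (rule ccontr)
    assume "\<not> \<sigma> a < \<sigma> b"
    then have "\<sigma> b < \<sigma> a"
      using inj[of a b] that by force
    moreover have "b < \<sigma> b" "\<sigma> a \<le> n"
      using left[of b] mem[of a] that j2 jn by auto
    ultimately have "contains_pattern n \<sigma> [4, 3, 2, 1]"
      unfolding contains_4321_iff using that self
      by (intro exI[of _ a] exI[of _ b] exI[of _ "\<sigma> b"] exI[of _ "\<sigma> a"]) simp
    with no4321 show False
      by simp
  qed
  \<comment> \<open>The positions of the block after \<open>i\<close> bound \<open>\<sigma> i\<close> from above, those before \<open>i\<close> bound it from below.\<close>
  have low: "\<sigma> i = n - j + i" if i: "1 \<le> i" "i \<le> j" for i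
  proof -
    have "card {i<..j} \<le> card {\<sigma> i<..n}"
      using left_mono[of i] mem i jn by (intro squeeze) auto
    moreover have "card {1..<i} \<le> card {n - j<..<\<sigma> i}"
      using left_mono[of _ i] left i by (intro squeeze) auto
    ultimately show ?thesis
      using i left[of i] mem[of i] jn by simp
  qed
  have high: "\<sigma> i = i - (n - j)" if "n - j < i" "i \<le> n" for i
  proof -
    have "\<sigma> (i - (n - j)) = i"
      using low[of "i - (n - j)"] that jn by simp
    then show ?thesis
      using self[of "i - (n - j)"] by simp
  qed
  have mid_bounds: "j < \<sigma> i \<and> \<sigma> i \<le> n - j" if "j < i" "i \<le> n - j" for i
  proof -
    have "j < \<sigma> i"
    proof (rule ccontr)
      assume "\<not> j < \<sigma> i"
      then have "n - j < \<sigma> (\<sigma> i)"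
        using mem[of i] that by (intro left) auto
      then show False
        using self that by simp
    qed
    then show ?thesis
      using right[of i] that by simp
  qed
  have mid_mono: "\<sigma> a < \<sigma> b" if "j < a" "a < b" "b \<le> n - j" for a b
  proof (rule ccontr)
    assume "\<not> \<sigma> a < \<sigma> b"
    then have "\<sigma> b < \<sigma> a"
      using inj[of a b] that by force
    moreover have "b < n" "\<sigma> a < n" "j < \<sigma> b"
      using that mid_bounds[of a] mid_bounds[of b] j1 jn by auto
    ultimately have "contains_pattern n \<sigma> [4, 3, 2, 1]"
      unfolding contains_4321_iff using that \<sigma>j \<sigma>n j1
      by (intro exI[of _ j] exI[of _ a] exI[of _ b] exI[of _ n]) simp
    with no4321 show False
      by simp
  qed
  \<comment> \<open>An increasing involution is the identity: \<open>i < \<sigma> i\<close> would give \<open>\<sigma> i < \<sigma> (\<sigma> i) = i\<close>.\<close>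
  have mid: "\<sigma> i = i" if "j < i" "i \<le> n - j" for i
  proof -
    have "\<not> i < \<sigma> i" "\<not> \<sigma> i < i"
      using mid_mono[of i "\<sigma> i"] mid_mono[of "\<sigma> i" i] mid_bounds[OF that] self[of i] that
      by auto
    then show ?thesis
      by simp
  qed
  show "\<sigma> = block_swap n j"
  proof
    fix i
    consider "1 \<le> i" "i \<le> j" | "j < i" "i \<le> n - j" | "n - j < i" "i \<le> n" "j < i"
      | "\<not> (1 \<le> i \<and> i \<le> n)"
      by linarith
    then show "\<sigma> i = block_swap n j i"
    proof cases
      case 1
      then show ?thesis using low by (simp add: block_swap_def)
    next
      case 2
      then show ?thesis using mid by (simp add: block_swap_def)
    next
      case 3
      then show ?thesis using high by (simp add: block_swap_def)
    next
      case 4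
      then show ?thesis using involution_outside[OF inv, of i] jn by (auto simp: block_swap_def)
    qed
  qed
qed

text \<open>
  A fixed last point carries the largest value, and in neither 4321 nor 132 is the last entry
  the largest. So this point takes part in no occurrence.
\<close>

lemma fixing_last_point_avoids_4321_132_iff:
  "\<sigma> \<in> involutions_avoiding (Suc n) [4, 3, 2, 1] [1, 3, 2] \<and> \<sigma> (Suc n) = Suc n \<longleftrightarrow>
   \<sigma> \<in> involutions_avoiding n [4, 3, 2, 1] [1, 3, 2]"
  (is "?L \<longleftrightarrow> ?R")
proof -
  have involutions: "\<sigma> \<in> involutions (Suc n) \<and> \<sigma> (Suc n) = Suc n \<longleftrightarrow> \<sigma> \<in> involutions n"
  proof
    assume \<sigma>: "\<sigma> \<in> involutions (Suc n) \<and> \<sigma> (Suc n) = Suc n"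
    then show "\<sigma> \<in> involutions n"
    proof (intro involutionsI)
      fix i
      assume "i \<notin> {1..n}"
      then show "\<sigma> i = i"
        using \<sigma> involution_outside[of \<sigma> "Suc n" i] by (cases "i = Suc n") auto
    qed (use \<sigma> involutionsD(2) in blast)
  next
    assume \<sigma>: "\<sigma> \<in> involutions n"
    have "\<sigma> \<in> involutions (Suc n)"
      using involutionsD(2)[OF \<sigma>] involution_outside[OF \<sigma>] by (intro involutionsI) auto
    then show "\<sigma> \<in> involutions (Suc n) \<and> \<sigma> (Suc n) = Suc n"
      using involution_outside[OF \<sigma>, of "Suc n"] by simp
  qed
  have "contains_pattern (Suc n) \<sigma> [4, 3, 2, 1] \<longleftrightarrow> contains_pattern n \<sigma> [4, 3, 2, 1]"
       "contains_pattern (Suc n) \<sigma> [1, 3, 2] \<longleftrightarrow> contains_pattern n \<sigma> [1, 3, 2]"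
    if \<sigma>: "\<sigma> \<in> involutions (Suc n)" "\<sigma> (Suc n) = Suc n"
  proof -
    have le: "\<sigma> x \<le> Suc n" if "1 \<le> x" "x < y" "y \<le> Suc n" for x y
      using involution_mem_iff[OF \<sigma>(1), of x] that by simp
    show "contains_pattern (Suc n) \<sigma> [4, 3, 2, 1] \<longleftrightarrow> contains_pattern n \<sigma> [4, 3, 2, 1]"
    proof
      assume "contains_pattern (Suc n) \<sigma> [4, 3, 2, 1]"
      then obtain a b c d where abcd: "1 \<le> a" "a < b" "b < c" "c < d" "d \<le> Suc n"
          "\<sigma> d < \<sigma> c" "\<sigma> c < \<sigma> b" "\<sigma> b < \<sigma> a"
        unfolding contains_4321_iff by blast
      then have "d \<noteq> Suc n"
        using \<sigma>(2) le[of c d] by auto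
      then have "d \<le> n"
        using abcd by simp
      then show "contains_pattern n \<sigma> [4, 3, 2, 1]"
        unfolding contains_4321_iff using abcd by blast
    next
      assume "contains_pattern n \<sigma> [4, 3, 2, 1]"
      then show "contains_pattern (Suc n) \<sigma> [4, 3, 2, 1]"
        unfolding contains_4321_iff using le_SucI by blast
    qed
    show "contains_pattern (Suc n) \<sigma> [1, 3, 2] \<longleftrightarrow> contains_pattern n \<sigma> [1, 3, 2]"
    proof
      assume "contains_pattern (Suc n) \<sigma> [1, 3, 2]"
      then obtain a b c where abc: "1 \<le> a" "a < b" "b < c" "c \<le> Suc n"
          "\<sigma> a < \<sigma> c" "\<sigma> c < \<sigma> b"
        unfolding contains_132_iff by blast
      then have "c \<noteq> Suc n"
        using \<sigma>(2) le[of b c] by auto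
      then have "c \<le> n"
        using abc by simp
      then show "contains_pattern n \<sigma> [1, 3, 2]"
        unfolding contains_132_iff using abc by blast
    next
      assume "contains_pattern n \<sigma> [1, 3, 2]"
      then show "contains_pattern (Suc n) \<sigma> [1, 3, 2]"
        unfolding contains_132_iff using le_SucI by blast
    qed
  qed
  then show ?thesis
    using involutions unfolding involutions_avoiding_def by blast
qed

text \<open>
  The involutions fixing the last point contribute the previous count, and those moving it are the
  \<open>\<lfloor>n / 2\<rfloor>\<close> block swaps, told apart by their value at the last point. These increments sum to
  the stated product.
\<close>

lemma card_involutions_avoiding_4321_132:
  "card (involutions_avoiding n [4, 3, 2, 1] [1, 3, 2]) = 1 + n div 2 * (Suc n div 2)"
proof (induction n)
  case 0
  have "involutions_avoiding 0 [4, 3, 2, 1] [1, 3, 2] = {id}"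
    unfolding involutions_avoiding_def involutions_0 contains_4321_iff contains_132_iff by auto
  then show ?case
    by simp
next
  case (Suc n)
  let ?M = "\<lambda>n. involutions_avoiding n [4, 3, 2, 1] [1, 3, 2]"
  let ?B = "block_swap (Suc n) ` {1..Suc n div 2}"
  have "?M (Suc n) = ?M n \<union> ?B"
  proof
    show "?M (Suc n) \<subseteq> ?M n \<union> ?B"
    proof
      fix \<sigma>
      assume \<sigma>: "\<sigma> \<in> ?M (Suc n)"
      show "\<sigma> \<in> ?M n \<union> ?B"
      proof (cases "\<sigma> (Suc n) = Suc n")
        case True
        then show ?thesis
          using \<sigma> fixing_last_point_avoids_4321_132_iff by blast
      next
        case False
        note swap = moving_last_point_imp_block_swap[OF \<sigma> le_add1[of 1 n, unfolded plus_1_eq_Suc] False]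
        have "\<sigma> (Suc n) \<in> {1..Suc n div 2}"
          using swap(1,2) by auto
        then show ?thesis
          using swap(3) by blast
      qed
    qed
    show "?M n \<union> ?B \<subseteq> ?M (Suc n)"
      using fixing_last_point_avoids_4321_132_iff block_swap_avoids_4321_132[of _ "Suc n"] by auto
  qed
  moreover have "?M n \<inter> ?B = {}"
  proof -
    have "\<sigma> (Suc n) = Suc n" if "\<sigma> \<in> ?M n" for \<sigma>
      using that fixing_last_point_avoids_4321_132_iff by blast
    moreover have "\<sigma> (Suc n) \<noteq> Suc n" if "\<sigma> \<in> ?B" for \<sigma>
      using that block_swap_last[of _ "Suc n"] by auto
    ultimately show ?thesis
      by blast
  qed
  moreover have "card ?B = Suc n div 2"
  proof -
    have "inj_on (block_swap (Suc n)) {1..Suc n div 2}"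
      by (rule inj_on_inverseI[where g = "\<lambda>\<sigma>. \<sigma> (Suc n)"]) (auto intro!: block_swap_last)
    then show ?thesis
      by (simp add: card_image)
  qed
  ultimately have "card (?M (Suc n)) = card (?M n) + Suc n div 2"
    by (simp add: card_Un_disjoint finite_involutions_avoiding)
  also have "\<dots> = 1 + Suc n div 2 * (Suc (Suc n) div 2)"
    using Suc.IH by simp
  finally show ?case .
qed

text \<open>
  Conjugating with this map is the reverse-complement symmetry, which turns the
  permutation diagram by 180 degrees. It sends 132 to 213 and fixes 4321.
\<close>

definition reversal :: "nat \<Rightarrow> nat \<Rightarrow> nat" where
  "reversal n i = (if 1 \<le> i \<and> i \<le> n then n + 1 - i else i)"

lemma reversal_reversal: "reversal n (reversal n i) = i"
  by (auto simp: reversal_def)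

lemma reversal_mem_iff: "1 \<le> reversal n i \<and> reversal n i \<le> n \<longleftrightarrow> 1 \<le> i \<and> i \<le> n"
  by (auto simp: reversal_def)

lemma reversal_less_iff:
  "\<lbrakk>1 \<le> i; i \<le> n; 1 \<le> k; k \<le> n\<rbrakk> \<Longrightarrow> reversal n i < reversal n k \<longleftrightarrow> k < i"
  by (auto simp: reversal_def)

lemma reverse_complement_in_involutions:
  assumes "\<sigma> \<in> involutions n"
  shows "reversal n \<circ> \<sigma> \<circ> reversal n \<in> involutions n"
proof (rule involutionsI)
  fix i
  show "(reversal n \<circ> \<sigma> \<circ> reversal n) ((reversal n \<circ> \<sigma> \<circ> reversal n) i) = i"
    by (simp add: reversal_reversal involutionsD(2)[OF assms])
next
  fix i
  assume "i \<notin> {1..n}"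
  then show "(reversal n \<circ> \<sigma> \<circ> reversal n) i = i"
    using involution_outside[OF assms, of i] by (auto simp: reversal_def)
qed

lemma reverse_complement_less_iff:
  assumes "\<sigma> \<in> involutions n" "1 \<le> i" "i \<le> n" "1 \<le> k" "k \<le> n"
  shows "(reversal n \<circ> \<sigma> \<circ> reversal n) (reversal n i) < (reversal n \<circ> \<sigma> \<circ> reversal n) (reversal n k)
    \<longleftrightarrow> \<sigma> k < \<sigma> i"
  using involution_mem_iff[OF assms(1), of i] involution_mem_iff[OF assms(1), of k] assms
  by (simp add: reversal_reversal reversal_less_iff)

lemma reverse_complement_contains:
  assumes \<sigma>: "\<sigma> \<in> involutions n"
  defines "\<sigma>' \<equiv> reversal n \<circ> \<sigma> \<circ> reversal n"
  shows "contains_pattern n \<sigma> [4, 3, 2, 1] \<Longrightarrow> contains_pattern n \<sigma>' [4, 3, 2, 1]"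
    and "contains_pattern n \<sigma> [1, 3, 2] \<Longrightarrow> contains_pattern n \<sigma>' [2, 1, 3]"
    and "contains_pattern n \<sigma> [2, 1, 3] \<Longrightarrow> contains_pattern n \<sigma>' [1, 3, 2]"
proof -
  let ?r = "reversal n"
  have less: "\<sigma>' (?r i) < \<sigma>' (?r k) \<longleftrightarrow> \<sigma> k < \<sigma> i" if "1 \<le> i" "i \<le> n" "1 \<le> k" "k \<le> n" for i k
    unfolding \<sigma>'_def using reverse_complement_less_iff[OF \<sigma> that] .
  have r: "1 \<le> ?r i" "?r i \<le> n" if "1 \<le> i" "i \<le> n" for i
    using that reversal_mem_iff by blast+
  {
    assume "contains_pattern n \<sigma> [4, 3, 2, 1]"
    then obtain a b c d where "1 \<le> a" "a < b" "b < c" "c < d" "d \<le> n"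
        "\<sigma> d < \<sigma> c" "\<sigma> c < \<sigma> b" "\<sigma> b < \<sigma> a"
      unfolding contains_4321_iff by blast
    note occ = this
    then have bounds: "1 \<le> b" "1 \<le> c" "1 \<le> d" "a \<le> n" "b \<le> n" "c \<le> n"
      by linarith+
    have "1 \<le> ?r d" "?r d < ?r c" "?r c < ?r b" "?r b < ?r a" "?r a \<le> n"
      using r[of d] r[of a] occ bounds by (simp_all add: reversal_less_iff)
    moreover have "\<sigma>' (?r a) < \<sigma>' (?r b)" "\<sigma>' (?r b) < \<sigma>' (?r c)" "\<sigma>' (?r c) < \<sigma>' (?r d)"
      using occ bounds by (simp_all add: less)
    ultimately show "contains_pattern n \<sigma>' [4, 3, 2, 1]"
      unfolding contains_4321_iff by blast
  }
  {
    assume "contains_pattern n \<sigma> [1, 3, 2]"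
    then obtain a b c where "1 \<le> a" "a < b" "b < c" "c \<le> n" "\<sigma> a < \<sigma> c" "\<sigma> c < \<sigma> b"
      unfolding contains_132_iff by blast
    note occ = this
    then have bounds: "1 \<le> b" "1 \<le> c" "a \<le> n" "b \<le> n"
      by linarith+
    have "1 \<le> ?r c" "?r c < ?r b" "?r b < ?r a" "?r a \<le> n"
      using r[of c] r[of a] occ bounds by (simp_all add: reversal_less_iff)
    moreover have "\<sigma>' (?r b) < \<sigma>' (?r c)" "\<sigma>' (?r c) < \<sigma>' (?r a)"
      using occ bounds by (simp_all add: less)
    ultimately show "contains_pattern n \<sigma>' [2, 1, 3]"
      unfolding contains_213_iff by blast
  }
  {
    assume "contains_pattern n \<sigma> [2, 1, 3]"
    then obtain a b c where "1 \<le> a" "a < b" "b < c" "c \<le> n" "\<sigma> b < \<sigma> a" "\<sigma> a < \<sigma> c"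
      unfolding contains_213_iff by blast
    note occ = this
    then have bounds: "1 \<le> b" "1 \<le> c" "a \<le> n" "b \<le> n"
      by linarith+
    have "1 \<le> ?r c" "?r c < ?r b" "?r b < ?r a" "?r a \<le> n"
      using r[of c] r[of a] occ bounds by (simp_all add: reversal_less_iff)
    moreover have "\<sigma>' (?r c) < \<sigma>' (?r a)" "\<sigma>' (?r a) < \<sigma>' (?r b)"
      using occ bounds by (simp_all add: less)
    ultimately show "contains_pattern n \<sigma>' [1, 3, 2]"
      unfolding contains_132_iff by blast
  }
qed

lemma card_involutions_avoiding_4321_213_eq_132:
  "card (involutions_avoiding n [4, 3, 2, 1] [2, 1, 3]) =
   card (involutions_avoiding n [4, 3, 2, 1] [1, 3, 2])"
proof (rule bij_betw_same_card)
  let ?c = "\<lambda>\<sigma>. reversal n \<circ> \<sigma> \<circ> reversal n"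
  have cc: "?c (?c \<sigma>) = \<sigma>" for \<sigma>
    by (simp add: fun_eq_iff reversal_reversal)
  have "?c \<sigma> \<in> involutions_avoiding n [4, 3, 2, 1] [1, 3, 2]"
    if "\<sigma> \<in> involutions_avoiding n [4, 3, 2, 1] [2, 1, 3]" for \<sigma>
    using that reverse_complement_in_involutions[of \<sigma> n]
      reverse_complement_contains(1,2)[of "?c \<sigma>" n]
    unfolding involutions_avoiding_def cc by blast
  moreover have "?c \<sigma> \<in> involutions_avoiding n [4, 3, 2, 1] [2, 1, 3]"
    if "\<sigma> \<in> involutions_avoiding n [4, 3, 2, 1] [1, 3, 2]" for \<sigma>
    using that reverse_complement_in_involutions[of \<sigma> n]
      reverse_complement_contains(1,3)[of "?c \<sigma>" n]
    unfolding involutions_avoiding_def cc by blast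
  ultimately show "bij_betw ?c (involutions_avoiding n [4, 3, 2, 1] [2, 1, 3])
      (involutions_avoiding n [4, 3, 2, 1] [1, 3, 2])"
    using cc by (intro bij_betw_byWitness[where f' = ?c]) auto
qed

section \<open>Avoiding 321: lattice paths with level steps at height 0\<close>

text \<open>
  Read \<open>U\<close> as the up steps and \<open>D\<close> as the down steps of a lattice path of length \<open>n\<close>, all other
  points being level steps. The pairs are exactly the paths from height 0 to height \<open>h\<close> that never
  go below height 0 and have level steps at height 0 only. Heights \<open>h > 0\<close> are needed to set up a
  recursion; involutions correspond to \<open>h = 0\<close>.
\<close>

definition arc_profiles :: "nat \<Rightarrow> nat \<Rightarrow> (nat set \<times> nat set) set" where
  "arc_profiles n h = {(U, D). U \<subseteq> {1..n} \<and> D \<subseteq> {1..n} \<and> U \<inter> D = {} \<and> card U = card D + h \<and>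
     (\<forall>i. card (D \<inter> {..i}) \<le> card (U \<inter> {..i})) \<and>
     (\<forall>f \<in> {1..n} - (U \<union> D). card (D \<inter> {..f}) = card (U \<inter> {..f}))}"

lemma finite_arc_profiles: "finite (arc_profiles n h)"
  by (rule finite_subset[of _ "Pow {1..n} \<times> Pow {1..n}"]) (auto simp: arc_profiles_def)

lemma arc_profilesD:
  assumes "(U, D) \<in> arc_profiles n h"
  shows "U \<subseteq> {1..n}" "D \<subseteq> {1..n}" "U \<inter> D = {}" "card U = card D + h" "finite U" "finite D"
    "card (D \<inter> {..i}) \<le> card (U \<inter> {..i})"
    "f \<in> {1..n} \<Longrightarrow> f \<notin> U \<Longrightarrow> f \<notin> D \<Longrightarrow> card (D \<inter> {..f}) = card (U \<inter> {..f})"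
  using assms finite_subset[of _ "{1..n}"] by (auto simp: arc_profiles_def)

lemma arc_profiles_0: "arc_profiles 0 h = (if h = 0 then {({}, {})} else {})"
  by (auto simp: arc_profiles_def)

text \<open>
  Removing the last step. A final level step is possible only at height 0, which is exactly
  where a final up step is impossible, so the two cases exclude each other.
\<close>

lemma arc_profiles_Suc:
  "arc_profiles (Suc n) h =
     (if h = 0 then arc_profiles n 0 else apfst (insert (Suc n)) ` arc_profiles n (h - 1)) \<union>
     apsnd (insert (Suc n)) ` arc_profiles n (Suc h)"
  (is "?L = ?R")
proof
  have cut: "insert (Suc n) X \<inter> {..i} = (if i \<le> n then X \<inter> {..i} else insert (Suc n) X)"
      "X \<inter> {..i} = (if i \<le> n then X \<inter> {..i} else X)"
    if "X \<subseteq> {1..n}" for X i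
    using that by auto
  have level_n: "X \<inter> {..n} = X" if "X \<subseteq> {1..n}" for X
    using that by auto
  show "?L \<subseteq> ?R"
  proof (rule subrelI, rule ccontr)
    fix U D
    assume UD: "(U, D) \<in> arc_profiles (Suc n) h" and notin: "(U, D) \<notin> ?R"
    note p = arc_profilesD[OF UD]
    consider "Suc n \<in> U" | "Suc n \<in> D" | "Suc n \<notin> U" "Suc n \<notin> D"
      by blast
    then show False
    proof cases
      case 1
      define V where "V = U - {Suc n}"
      have U: "U = insert (Suc n) V" "Suc n \<notin> V"
        using 1 by (auto simp: V_def)
      have V: "V \<subseteq> {1..n}" "D \<subseteq> {1..n}"
        using p(1-3) U by (auto simp: le_Suc_eq)
      have "card U = Suc (card V)"
        using U p(5) by simp
      moreover have "card D \<le> card V"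
        using p(7)[of n] level_n[OF V(1)] level_n[OF V(2)] U by simp
      ultimately have h: "h \<noteq> 0" "card V = card D + (h - 1)"
        using p(4) by auto
      have "(V, D) \<in> arc_profiles n (h - 1)"
        unfolding arc_profiles_def
      proof (intro CollectI case_prodI conjI allI ballI)
        show "card (D \<inter> {..i}) \<le> card (V \<inter> {..i})" for i
          using p(7)[of i] cut[OF V(1), of i] cut[OF V(2), of i] U \<open>card D \<le> card V\<close>
          by (cases "i \<le> n") simp_all
        show "card (D \<inter> {..f}) = card (V \<inter> {..f})" if "f \<in> {1..n} - (V \<union> D)" for f
          using p(8)[of f] that cut[OF V(1), of f] U by auto
      qed (use V h p(3) U in auto)
      then have "(U, D) \<in> apfst (insert (Suc n)) ` arc_profiles n (h - 1)"
        using U by (intro image_eqI[of _ _ "(V, D)"]) auto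
      then show False
        using notin h by simp
    next
      case 2
      define E where "E = D - {Suc n}"
      have D: "D = insert (Suc n) E" "Suc n \<notin> E"
        using 2 by (auto simp: E_def)
      have E: "E \<subseteq> {1..n}" "U \<subseteq> {1..n}"
        using p(1-3) D by (auto simp: le_Suc_eq)
      have h: "card U = card E + Suc h"
        using D p(4,6) by simp
      have "(U, E) \<in> arc_profiles n (Suc h)"
        unfolding arc_profiles_def
      proof (intro CollectI case_prodI conjI allI ballI)
        show "card (E \<inter> {..i}) \<le> card (U \<inter> {..i})" for i
          using p(7)[of i] cut[OF E(1), of i] cut[OF E(2), of i] D h
          by (cases "i \<le> n") simp_all
        show "card (E \<inter> {..f}) = card (U \<inter> {..f})" if "f \<in> {1..n} - (U \<union> E)" for f
          using p(8)[of f] that cut[OF E(1), of f] D by auto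
      qed (use E h p(3) D in auto)
      then have "(U, D) \<in> apsnd (insert (Suc n)) ` arc_profiles n (Suc h)"
        using D by (intro image_eqI[of _ _ "(U, E)"]) auto
      then show False
        using notin by simp
    next
      case 3
      then have sub: "U \<subseteq> {1..n}" "D \<subseteq> {1..n}"
        using p(1,2) by (auto simp: le_Suc_eq)
      have "card D = card U"
        using p(8)[of "Suc n"] 3 cut(2)[OF sub(1), of "Suc n"] cut(2)[OF sub(2), of "Suc n"] by simp
      then have h: "h = 0"
        using p(4) by simp
      have "(U, D) \<in> arc_profiles n 0"
        unfolding arc_profiles_def using sub p h by auto
      then show False
        using notin h by simp
    qed
  qed
  show "?R \<subseteq> ?L"
  proof -
    have flat: "(U, D) \<in> ?L" if UD: "(U, D) \<in> arc_profiles n h" "h = 0" for U D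
    proof -
      note p = arc_profilesD[OF UD(1)]
      show ?thesis
        unfolding arc_profiles_def
      proof (intro CollectI case_prodI conjI allI ballI)
        show "card (D \<inter> {..f}) = card (U \<inter> {..f})" if "f \<in> {1..Suc n} - (U \<union> D)" for f
          using that p(8)[of f] p(4) UD(2) cut(2)[OF p(1), of f] cut(2)[OF p(2), of f]
          by (cases "f \<le> n") auto
      qed (use p in auto)
    qed
    have up: "(insert (Suc n) U, D) \<in> ?L" if UD: "(U, D) \<in> arc_profiles n (h - 1)" "h \<noteq> 0" for U D
    proof -
      note p = arc_profilesD[OF UD(1)]
      have new: "Suc n \<notin> U" "Suc n \<notin> D"
        using p(1,2) by auto
      show ?thesis
        unfolding arc_profiles_def
      proof (intro CollectI case_prodI conjI allI ballI)
        show "card (D \<inter> {..i}) \<le> card (insert (Suc n) U \<inter> {..i})" for i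
          using p(4,5) p(7)[of i] cut[OF p(1), of i] cut(2)[OF p(2), of i] new
          by (cases "i \<le> n") simp_all
        show "card (D \<inter> {..f}) = card (insert (Suc n) U \<inter> {..f})"
          if "f \<in> {1..Suc n} - (insert (Suc n) U \<union> D)" for f
          using that p(8)[of f] cut(1)[OF p(1), of f] by auto
      qed (use p(1-6) new UD(2) in auto)
    qed
    have down: "(U, insert (Suc n) D) \<in> ?L" if UD: "(U, D) \<in> arc_profiles n (Suc h)" for U D
    proof -
      note p = arc_profilesD[OF UD(1)]
      have new: "Suc n \<notin> U" "Suc n \<notin> D"
        using p(1,2) by auto
      show ?thesis
        unfolding arc_profiles_def
      proof (intro CollectI case_prodI conjI allI ballI)
        show "card (insert (Suc n) D \<inter> {..i}) \<le> card (U \<inter> {..i})" for i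
          using p(4,6) p(7)[of i] cut(2)[OF p(1), of i] cut(1)[OF p(2), of i] new
          by (cases "i \<le> n") simp_all
        show "card (insert (Suc n) D \<inter> {..f}) = card (U \<inter> {..f})"
          if "f \<in> {1..Suc n} - (U \<union> insert (Suc n) D)" for f
          using that p(8)[of f] cut(1)[OF p(2), of f] by auto
      qed (use p(1-6) new in auto)
    qed
    show ?thesis
      using flat up down by (auto split: if_splits)
  qed
qed

text \<open>
  The truncated subtraction makes the formula uniform: for \<open>h = 0\<close> the term \<open>h - 1 = 0\<close> counts
  the paths with a final level step.
\<close>

lemma card_arc_profiles_Suc:
  "card (arc_profiles (Suc n) h) =
     card (arc_profiles n (h - 1)) + card (arc_profiles n (Suc h))"
proof -
  let ?up = "if h = 0 then arc_profiles n 0 else apfst (insert (Suc n)) ` arc_profiles n (h - 1)"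
  let ?down = "apsnd (insert (Suc n)) ` arc_profiles n (Suc h)"
  have new: "Suc n \<notin> U" "Suc n \<notin> D" if "(U, D) \<in> arc_profiles n k" for U D k
    using arc_profilesD(1,2)[OF that] by auto
  have "?up \<inter> ?down = {}"
    using new by (fastforce split: if_splits)
  moreover have "card ?up = card (arc_profiles n (h - 1))"
  proof -
    have "inj_on (apfst (insert (Suc n))) (arc_profiles n (h - 1))"
      using new by (auto simp: inj_on_def dest!: insert_ident[THEN iffD1, rotated 2])
    then show ?thesis
      by (simp add: card_image)
  qed
  moreover have "card ?down = card (arc_profiles n (Suc h))"
  proof -
    have "inj_on (apsnd (insert (Suc n))) (arc_profiles n (Suc h))"
      using new by (auto simp: inj_on_def dest!: insert_ident[THEN iffD1, rotated 2])
    then show ?thesis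
      by (simp add: card_image)
  qed
  ultimately show ?thesis
    unfolding arc_profiles_Suc by (simp add: card_Un_disjoint finite_arc_profiles)
qed

text \<open>
  For \<open>h > 0\<close> the recursion is Pascal's rule. For \<open>h = 0\<close> it is Pascal's rule directly when \<open>n + 1\<close>
  is odd; when \<open>n + 1\<close> is even, its two summands are equal and the symmetry of the binomial
  coefficients around the middle is needed.
\<close>

lemma card_arc_profiles:
  "card (arc_profiles n h) = (if h \<le> n then n choose ((n - h) div 2) else 0)"
proof (induction n arbitrary: h)
  case 0
  show ?case
    by (simp add: arc_profiles_0)
next
  case (Suc n)
  consider "h = 0" "even n" | "h = 0" "odd n" | "0 < h" "h < n" | "0 < h" "h = n" | "h = Suc n" | "Suc n < h"
    by linarith
  then show ?case
  proof cases
    case 1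
    then obtain m where m: "n = 2 * m"
      by blast
    show ?thesis
    proof (cases m)
      case (Suc k)
      then have "(n - Suc 0) div 2 = k" "Suc n div 2 = Suc k" "n div 2 = Suc k"
        using m by auto
      then show ?thesis
        unfolding card_arc_profiles_Suc Suc.IH using 1 m Suc by simp
    qed (use m 1 in \<open>simp add: card_arc_profiles_Suc Suc.IH arc_profiles_0\<close>)
  next
    case 2
    then obtain m where m: "n = 2 * m + 1"
      by (blast elim: oddE)
    then have "(n - Suc 0) div 2 = m" "Suc n div 2 = Suc m" "n div 2 = m"
      by auto
    moreover have "n choose m = n choose Suc m"
      using binomial_symmetric[of m n] m by simp
    ultimately show ?thesis
      unfolding card_arc_profiles_Suc Suc.IH using 2 m by simp
  next
    case 3
    define k where "k = (n - Suc h) div 2"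
    have "(n - (h - 1)) div 2 = Suc k" "(Suc n - h) div 2 = Suc k"
      using 3 by (auto simp: k_def)
    then show ?thesis
      unfolding card_arc_profiles_Suc Suc.IH using 3 by (simp add: k_def)
  next
    case 4
    then show ?thesis
      by (simp add: card_arc_profiles_Suc Suc.IH)
  next
    case 5
    then show ?thesis
      by (simp add: card_arc_profiles_Suc Suc.IH)
  next
    case 6
    then show ?thesis
      by (simp add: card_arc_profiles_Suc Suc.IH)
  qed
qed

text \<open>
  At the least point where the two maps differ, the smaller of the two values would have to be
  taken by the other map at an earlier point, where the maps agree.
\<close>

lemma strict_mono_on_same_image_unique:
  fixes f g :: "nat \<Rightarrow> nat"
  assumes "strict_mono_on A f" "strict_mono_on A g" "f ` A = g ` A" "x \<in> A"
  shows "f x = g x"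
  using assms(4)
proof (induction x rule: less_induct)
  case (less x)
  have *: "\<not> p x < q x"
    if p: "strict_mono_on A p" and q: "strict_mono_on A q" and im: "p ` A = q ` A"
      and IH: "\<And>y. y < x \<Longrightarrow> y \<in> A \<Longrightarrow> p y = q y" for p q :: "nat \<Rightarrow> nat"
  proof
    assume lt: "p x < q x"
    obtain y where y: "y \<in> A" "p x = q y"
      using less.prems im by blast
    then have "y < x"
      using strict_mono_on_less[OF q y(1) less.prems] lt by simp
    then show False
      using strict_mono_on_less[OF p y(1) less.prems] IH[of y] y by simp
  qed
  show ?case
    using *[OF assms(1,2)] *[OF assms(2,1)] assms(3) less.IH by (metis linorder_neqE_nat)
qed

text \<open>
  Match the elements of the two sets by rank.
\<close>

lemma ex_strict_mono_bij_betw: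
  fixes A B :: "nat set"
  assumes "finite A" "finite B" "card A = card B"
  obtains m where "bij_betw m A B" "strict_mono_on A m"
proof -
  obtain f where f: "bij_betw f {..<card A} A" "strict_mono_on {..<card A} f"
    using ex_bij_betw_strict_mono_card[OF assms(1)] .
  obtain g where g: "bij_betw g {..<card A} B" "strict_mono_on {..<card A} g"
    using ex_bij_betw_strict_mono_card[OF assms(2)] assms(3) by metis
  let ?m = "g \<circ> inv_into {..<card A} f"
  have "bij_betw ?m A B"
    using bij_betw_trans[OF bij_betw_inv_into[OF f(1)] g(1)] .
  moreover have "strict_mono_on A ?m"
  proof (rule strict_mono_onI)
    fix x y
    assume "x \<in> A" "y \<in> A" "x < y"
    then obtain s t where st: "s < card A" "t < card A" "x = f s" "y = f t"
      using bij_betw_imp_surj_on[OF f(1)] by (metis imageE lessThan_iff)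
    then have "s < t"
      using strict_mono_on_less[OF f(2), of s t] \<open>x < y\<close> by simp
    then show "?m x < ?m y"
      using st strict_mono_onD[OF g(2)] bij_betw_imp_inj_on[OF f(1)] by simp
  qed
  ultimately show thesis
    by (rule that)
qed

definition excedances :: "(nat \<Rightarrow> nat) \<Rightarrow> nat set" where
  "excedances \<sigma> = {i. i < \<sigma> i}"

definition deficiencies :: "(nat \<Rightarrow> nat) \<Rightarrow> nat set" where
  "deficiencies \<sigma> = {i. \<sigma> i < i}"

lemma involution_excedances:
  assumes "\<sigma> \<in> involutions n"
  shows "excedances \<sigma> \<subseteq> {1..n}" "deficiencies \<sigma> \<subseteq> {1..n}" "\<sigma> ` excedances \<sigma> = deficiencies \<sigma>"
proof -
  show "excedances \<sigma> \<subseteq> {1..n}" "deficiencies \<sigma> \<subseteq> {1..n}"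
    using involution_outside[OF assms] by (fastforce simp: excedances_def deficiencies_def)+
  show "\<sigma> ` excedances \<sigma> = deficiencies \<sigma>"
    using involutionsD(2)[OF assms]
    by (fastforce simp: excedances_def deficiencies_def intro: image_eqI[of x \<sigma> "\<sigma> x" for x])
qed

text \<open>
  Two nested arcs \<open>a < b < \<sigma> b < \<sigma> a\<close> give the decreasing values \<open>\<sigma> a > \<sigma> b > b\<close> at the
  positions \<open>a < b < \<sigma> b\<close>.
\<close>

lemma avoiding_321_strict_mono_on_excedances:
  assumes \<sigma>: "\<sigma> \<in> involutions n" and no321: "\<not> contains_pattern n \<sigma> [3, 2, 1]"
  shows "strict_mono_on (excedances \<sigma>) \<sigma>"
proof (rule strict_mono_onI, rule ccontr)
  fix a b
  assume ab: "a \<in> excedances \<sigma>" "b \<in> excedances \<sigma>" "a < b" "\<not> \<sigma> a < \<sigma> b"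
  then have "\<sigma> b < \<sigma> a"
    using involution_eq_iff[OF \<sigma>, of a b] by auto
  moreover have "b < \<sigma> b" "1 \<le> a" "1 \<le> b" "b \<le> n"
    using ab(1,2) involution_excedances(1)[OF \<sigma>] by (auto simp: excedances_def)
  moreover have "\<sigma> b \<le> n"
    using calculation ab(3) involution_mem_iff[OF \<sigma>, of b] by simp
  ultimately have "contains_pattern n \<sigma> [3, 2, 1]"
    unfolding contains_321_iff using ab(3) involutionsD(2)[OF \<sigma>]
    by (intro exI[of _ a] exI[of _ b] exI[of _ "\<sigma> b"]) simp
  with no321 show False
    by simp
qed

text \<open>
  Every deficiency is the right end of an arc that starts earlier, which gives the ballot
  condition. A fixed point under an arc would be the middle of a 321, so every arc that starts
  before a fixed point also ends before it, which puts fixed points at height 0.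
\<close>

lemma excedances_deficiencies_in_arc_profiles:
  assumes \<sigma>: "\<sigma> \<in> involutions n" and no321: "\<not> contains_pattern n \<sigma> [3, 2, 1]"
  shows "(excedances \<sigma>, deficiencies \<sigma>) \<in> arc_profiles n 0"
proof -
  let ?U = "excedances \<sigma>" and ?D = "deficiencies \<sigma>"
  note sub = involution_excedances[OF \<sigma>] and self = involutionsD(2)[OF \<sigma>]
  have inj: "inj_on \<sigma> A" for A
    using involution_eq_iff[OF \<sigma>] by (auto simp: inj_on_def)
  have fin: "finite ?U" "finite ?D"
    using sub(1,2) finite_subset by blast+
  have into: "\<sigma> ` (?D \<inter> {..i}) \<subseteq> ?U \<inter> {..i}" for i
    by (auto simp: excedances_def deficiencies_def self)
  show ?thesis
    unfolding arc_profiles_def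
  proof (intro CollectI case_prodI conjI allI ballI)
    show "card ?U = card ?D + 0"
      using card_image[OF inj, of ?U] sub(3) by simp
    show "card (?D \<inter> {..i}) \<le> card (?U \<inter> {..i})" for i
      using card_inj_on_le[OF inj into] fin by simp
    show "card (?D \<inter> {..f}) = card (?U \<inter> {..f})" if f: "f \<in> {1..n} - (?U \<union> ?D)" for f
    proof -
      have fix_f: "\<sigma> f = f"
        using f by (auto simp: excedances_def deficiencies_def)
      have "?U \<inter> {..f} \<subseteq> \<sigma> ` (?D \<inter> {..f})"
      proof
        fix u
        assume u: "u \<in> ?U \<inter> {..f}"
        then have "u \<noteq> f" "u \<le> f" "1 \<le> u"
          using f sub(1) by auto
        then have "u < f"
          by simp
        have "\<sigma> u \<le> f"
        proof (rule ccontr)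
          assume "\<not> \<sigma> u \<le> f"
          moreover have "\<sigma> u \<le> n"
            using involution_mem_iff[OF \<sigma>, of u] u sub(1) by auto
          ultimately have "contains_pattern n \<sigma> [3, 2, 1]"
            unfolding contains_321_iff using \<open>u < f\<close> \<open>1 \<le> u\<close> fix_f self
            by (intro exI[of _ u] exI[of _ f] exI[of _ "\<sigma> u"]) simp
          with no321 show False
            by simp
        qed
        then show "u \<in> \<sigma> ` (?D \<inter> {..f})"
          using u self by (intro image_eqI[of _ _ "\<sigma> u"]) (auto simp: excedances_def deficiencies_def)
      qed
      then have "\<sigma> ` (?D \<inter> {..f}) = ?U \<inter> {..f}"
        using into[of f] by simp
      then show ?thesis
        using card_image[OF inj, of "?D \<inter> {..f}"] by simp
    qed
  qed (use sub(1,2) in \<open>auto simp: excedances_def deficiencies_def\<close>)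
qed

text \<open>
  The excedances are matched in increasing order with the deficiencies, and such a matching is
  unique. The remaining points are fixed.
\<close>

lemma inj_on_excedances_deficiencies:
  "inj_on (\<lambda>\<sigma>. (excedances \<sigma>, deficiencies \<sigma>))
     {\<sigma> \<in> involutions n. \<not> contains_pattern n \<sigma> [3, 2, 1]}"
proof (rule inj_onI, clarify)
  fix \<sigma> \<tau>
  assume \<sigma>: "\<sigma> \<in> involutions n" "\<not> contains_pattern n \<sigma> [3, 2, 1]"
    and \<tau>: "\<tau> \<in> involutions n" "\<not> contains_pattern n \<tau> [3, 2, 1]"
    and U: "excedances \<sigma> = excedances \<tau>" and D: "deficiencies \<sigma> = deficiencies \<tau>"
  have up: "\<sigma> u = \<tau> u" if "u \<in> excedances \<sigma>" for u
  proof (rule strict_mono_on_same_image_unique[where f = \<sigma> and g = \<tau> and A = "excedances \<sigma>"])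
    show "strict_mono_on (excedances \<sigma>) \<sigma>" "strict_mono_on (excedances \<sigma>) \<tau>"
      using avoiding_321_strict_mono_on_excedances \<sigma> \<tau> U by metis+
    show "\<sigma> ` excedances \<sigma> = \<tau> ` excedances \<sigma>"
      using involution_excedances(3)[OF \<sigma>(1)] involution_excedances(3)[OF \<tau>(1)] U D by simp
  qed (fact that)
  show "\<sigma> = \<tau>"
  proof
    fix i
    consider "i \<in> excedances \<sigma>" | "i \<in> deficiencies \<sigma>" | "i \<notin> excedances \<sigma>" "i \<notin> deficiencies \<sigma>"
      by blast
    then show "\<sigma> i = \<tau> i"
    proof cases
      case 1
      then show ?thesis by (rule up)
    next
      case 2
      then obtain u where "u \<in> excedances \<sigma>" "i = \<sigma> u"
        using involution_excedances(3)[OF \<sigma>(1)] by blast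
      then show ?thesis
        using up[of u] involutionsD(2)[OF \<sigma>(1), of u] involutionsD(2)[OF \<tau>(1), of u] by simp
    next
      case 3
      moreover from this have "i \<notin> excedances \<tau>" "i \<notin> deficiencies \<tau>"
        using U D by auto
      ultimately show ?thesis
        by (simp add: excedances_def deficiencies_def)
    qed
  qed
qed

text \<open>
  Match up steps with down steps by rank. The ballot condition makes every arc run
  forward. In an occurrence of 321 the middle position can only be a fixed point lying under an arc;
  but at a fixed point all arcs that have started have ended already.
\<close>

lemma arc_profile_realized:
  assumes UD: "(U, D) \<in> arc_profiles n 0"
  obtains \<sigma> where "\<sigma> \<in> involutions n" "\<not> contains_pattern n \<sigma> [3, 2, 1]"
    "excedances \<sigma> = U" "deficiencies \<sigma> = D"
proof -
  note p = arc_profilesD[OF UD]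
  obtain m where m: "bij_betw m U D" "strict_mono_on U m"
    using ex_strict_mono_bij_betw[OF p(5,6)] p(4) by (metis add_0_right)
  have mD: "m u \<in> D" if "u \<in> U" for u
    using m(1) that by (auto simp: bij_betw_def)
  have m_less: "m u < m v \<longleftrightarrow> u < v" if "u \<in> U" "v \<in> U" for u v
    using strict_mono_on_less[OF m(2) that] .
  have up: "u < m u" if u: "u \<in> U" for u
  proof (rule ccontr)
    assume "\<not> u < m u"
    moreover have "m u \<noteq> u"
      using mD[OF u] u p(3) by auto
    ultimately have lt: "m u < u"
      by simp
    \<comment> \<open>The path would be too low at \<open>m u\<close>: as many down steps up to there as up steps up to the later point \<open>u\<close>.\<close>
    have "m ` (U \<inter> {..u}) = D \<inter> {..m u}"
    proof
      show "m ` (U \<inter> {..u}) \<subseteq> D \<inter> {..m u}"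
        using mD m_less[OF u] by (force simp: not_less[symmetric])
      show "D \<inter> {..m u} \<subseteq> m ` (U \<inter> {..u})"
        using m(1) m_less[OF u] by (force simp: bij_betw_def not_less[symmetric])
    qed
    then have "card (U \<inter> {..u}) = card (D \<inter> {..m u})"
      using card_image[of m "U \<inter> {..u}"] m(1) by (auto simp: bij_betw_def inj_on_Int)
    also have "\<dots> \<le> card (U \<inter> {..m u})"
      by (rule p(7))
    also have "\<dots> < card (U \<inter> {..u})"
    proof (rule psubset_card_mono)
      show "U \<inter> {..m u} \<subset> U \<inter> {..u}"
      proof (rule psubsetI)
        show "U \<inter> {..m u} \<noteq> U \<inter> {..u}"
          using lt u by (metis IntE IntI atMost_iff le_refl not_less)
      qed (use lt in auto)
    qed (use p(5) in simp)
    finally show False by simp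
  qed
  define w where "w = inv_into U m"
  have w: "w d \<in> U" "m (w d) = d" if "d \<in> D" for d
    using m(1) that unfolding w_def
    by (auto simp: bij_betw_def inv_into_into f_inv_into_f)
  have wm: "w (m u) = u" if "u \<in> U" for u
    using m(1) that unfolding w_def by (auto simp: bij_betw_def)
  define \<sigma> where "\<sigma> i = (if i \<in> U then m i else if i \<in> D then w i else i)" for i
  have on_U: "\<sigma> u = m u" if "u \<in> U" for u
    using that by (simp add: \<sigma>_def)
  have on_D: "\<sigma> d = w d" if "d \<in> D" for d
    using that p(3) by (auto simp: \<sigma>_def)
  have rest: "\<sigma> i = i" if "i \<notin> U" "i \<notin> D" for i
    using that by (simp add: \<sigma>_def)
  have down: "\<sigma> d < d" if "d \<in> D" for d
    using up[of "w d"] w[OF that] on_D[OF that] by simp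
  have inv: "\<sigma> \<in> involutions n"
  proof (rule involutionsI)
    fix i
    consider "i \<in> U" | "i \<in> D" | "i \<notin> U" "i \<notin> D"
      by blast
    then show "\<sigma> (\<sigma> i) = i"
      by cases (simp_all add: on_U on_D rest mD w wm)
  next
    fix i
    assume "i \<notin> {1..n}"
    then show "\<sigma> i = i"
      using p(1,2) by (intro rest) auto
  qed
  have U: "excedances \<sigma> = U" and D: "deficiencies \<sigma> = D"
  proof -
    have "i < \<sigma> i \<longleftrightarrow> i \<in> U" "\<sigma> i < i \<longleftrightarrow> i \<in> D" for i
      using up[of i] down[of i] on_U[of i] rest[of i] p(3) by force+
    then show "excedances \<sigma> = U" "deficiencies \<sigma> = D"
      by (auto simp: excedances_def deficiencies_def)
  qed
  have "\<not> contains_pattern n \<sigma> [3, 2, 1]"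
  proof
    assume "contains_pattern n \<sigma> [3, 2, 1]"
    then obtain a b c where abc: "1 \<le> a" "a < b" "b < c" "c \<le> n" "\<sigma> c < \<sigma> b" "\<sigma> b < \<sigma> a"
      unfolding contains_321_iff by blast
    have U_mono: "\<sigma> x < \<sigma> y" if "x \<in> U" "y \<in> U" "x < y" for x y
      using that m_less on_U by simp
    have D_mono: "\<sigma> x < \<sigma> y" if "x \<in> D" "y \<in> D" "x < y" for x y
      using that m_less[of "w x" "w y"] w on_D by simp
    have not_D: "x \<notin> D" if "x < y" "\<sigma> y < \<sigma> x" for x y
      using that down[of x] down[of y] D_mono[of x y] U_mono[of x y] up[of y] on_U[of y] rest[of y]
      by (metis less_asym less_trans)
    have not_U: "y \<notin> U" if "x < y" "\<sigma> y < \<sigma> x" for x y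
      using that down[of x] U_mono[of x y] up[of y] on_U[of y] rest[of x]
      by (metis less_asym less_trans)
    have "b \<notin> U" "b \<notin> D"
      using not_D[of b c] not_U[of a b] abc by auto
    then have b: "\<sigma> b = b"
      by (rule rest)
    have a: "a \<in> U"
      using not_D[of a b] rest[of a] b abc by fastforce
    have "card (D \<inter> {..b}) = card (U \<inter> {..b})"
      using p(8)[of b] \<open>b \<notin> U\<close> \<open>b \<notin> D\<close> abc by simp
    moreover have "card (D \<inter> {..b}) \<le> card (U \<inter> {..b} - {a})"
    proof (rule card_inj_on_le)
      show "inj_on \<sigma> (D \<inter> {..b})"
        using involution_eq_iff[OF inv] by (auto simp: inj_on_def)
      show "\<sigma> ` (D \<inter> {..b}) \<subseteq> U \<inter> {..b} - {a}"
        using on_D w down abc(6) b on_U by fastforce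
    qed (use p(5) in simp)
    moreover have "card (U \<inter> {..b} - {a}) < card (U \<inter> {..b})"
      using a abc p(5) by (intro card_Diff1_less) auto
    ultimately show False by simp
  qed
  with inv U D that show thesis by blast
qed

lemma card_involutions_avoiding_4321_321:
  "card (involutions_avoiding n [4, 3, 2, 1] [3, 2, 1]) = n choose (n div 2)"
proof -
  have "contains_pattern n \<sigma> [3, 2, 1]" if "contains_pattern n \<sigma> [4, 3, 2, 1]" for \<sigma>
    using that unfolding contains_4321_iff contains_321_iff by (meson less_trans)
  then have eq: "involutions_avoiding n [4, 3, 2, 1] [3, 2, 1] =
      {\<sigma> \<in> involutions n. \<not> contains_pattern n \<sigma> [3, 2, 1]}"
    unfolding involutions_avoiding_def by blast
  let ?f = "\<lambda>\<sigma>. (excedances \<sigma>, deficiencies \<sigma>)"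
  have "?f ` involutions_avoiding n [4, 3, 2, 1] [3, 2, 1] = arc_profiles n 0"
  proof
    show "?f ` involutions_avoiding n [4, 3, 2, 1] [3, 2, 1] \<subseteq> arc_profiles n 0"
      unfolding eq using excedances_deficiencies_in_arc_profiles by blast
    show "arc_profiles n 0 \<subseteq> ?f ` involutions_avoiding n [4, 3, 2, 1] [3, 2, 1]"
    proof clarify
      fix U D
      assume "(U, D) \<in> arc_profiles n 0"
      then obtain \<sigma> where "\<sigma> \<in> involutions n" "\<not> contains_pattern n \<sigma> [3, 2, 1]"
          "excedances \<sigma> = U" "deficiencies \<sigma> = D"
        by (rule arc_profile_realized)
      then show "(U, D) \<in> ?f ` involutions_avoiding n [4, 3, 2, 1] [3, 2, 1]"
        unfolding eq by blast
    qed
  qed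
  moreover have "inj_on ?f (involutions_avoiding n [4, 3, 2, 1] [3, 2, 1])"
    unfolding eq by (rule inj_on_excedances_deficiencies)
  ultimately show ?thesis
    using card_image[of ?f "involutions_avoiding n [4, 3, 2, 1] [3, 2, 1]"]
    by (simp add: card_arc_profiles)
qed

section \<open>Avoiding 4321 and 312: layers of length at most three\<close>

text \<open>
  Inverting a permutation exchanges positions and values, which turns 312 into its inverse 231; an
  involution is its own inverse.
\<close>

lemma involution_contains_312_iff_231:
  assumes "\<sigma> \<in> involutions n"
  shows "contains_pattern n \<sigma> [3, 1, 2] \<longleftrightarrow> contains_pattern n \<sigma> [2, 3, 1]"
proof
  assume "contains_pattern n \<sigma> [3, 1, 2]"
  then obtain a b c where "1 \<le> a" "a < b" "b < c" "c \<le> n" "\<sigma> b < \<sigma> c" "\<sigma> c < \<sigma> a"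
    unfolding contains_312_iff by blast
  then show "contains_pattern n \<sigma> [2, 3, 1]"
    unfolding contains_231_iff
    using involution_mem_iff[OF assms, of a] involution_mem_iff[OF assms, of b]
    by (intro exI[of _ "\<sigma> b"] exI[of _ "\<sigma> c"] exI[of _ "\<sigma> a"])
      (simp add: involutionsD(2)[OF assms])
next
  assume "contains_pattern n \<sigma> [2, 3, 1]"
  then obtain a b c where "1 \<le> a" "a < b" "b < c" "c \<le> n" "\<sigma> c < \<sigma> a" "\<sigma> a < \<sigma> b"
    unfolding contains_231_iff by blast
  then show "contains_pattern n \<sigma> [3, 1, 2]"
    unfolding contains_312_iff
    using involution_mem_iff[OF assms, of c] involution_mem_iff[OF assms, of b]
    by (intro exI[of _ "\<sigma> c"] exI[of _ "\<sigma> a"] exI[of _ "\<sigma> b"])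
      (simp add: involutionsD(2)[OF assms])
qed

text \<open>
  The transposition reverses the interval from \<open>j\<close> to \<open>n\<close>, since this interval has at most three points.
  All values on it exceed all earlier ones. Neither 312 nor 4321 splits into a lower part followed
  by a higher part, so an occurrence would lie either in the old permutation or in the
  new decreasing interval, which contains no ascent and no four points.
\<close>

lemma append_layer:
  assumes \<tau>: "\<tau> \<in> involutions_avoiding (j - 1) [4, 3, 2, 1] [3, 1, 2]"
    and j: "1 \<le> j" "j \<le> n" "n \<le> j + 2"
  shows "\<tau> \<circ> transpose j n \<in> involutions_avoiding n [4, 3, 2, 1] [3, 1, 2]"
proof -
  let ?\<sigma> = "\<tau> \<circ> transpose j n"
  have inv: "\<tau> \<in> involutions (j - 1)"
    and no4321: "\<not> contains_pattern (j - 1) \<tau> [4, 3, 2, 1]"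
    and no312: "\<not> contains_pattern (j - 1) \<tau> [3, 1, 2]"
    using \<tau> by (auto simp: involutions_avoiding_def)
  have fixed: "\<tau> i = i" if "j \<le> i" for i
    using involution_outside[OF inv, of i] that j by simp
  have low: "?\<sigma> i = \<tau> i" "?\<sigma> i < j" if "i < j" for i
  proof -
    show "?\<sigma> i = \<tau> i"
      using that j by (simp add: transpose_def)
    show "?\<sigma> i < j"
      using involution_mem_iff[OF inv, of i] involution_outside[OF inv, of i] that j
      by (cases "1 \<le> i") (auto simp: transpose_def)
  qed
  have layer: "?\<sigma> i = n + j - i" if "j \<le> i" "i \<le> n" for i
    using that j fixed[of j] fixed[of i] fixed[of n] by (auto simp: transpose_def)
  have high: "?\<sigma> i = i" if "n < i" for i
    using that j fixed[of i] by (simp add: transpose_def)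
  have "?\<sigma> \<in> involutions n"
  proof (rule involutionsI)
    fix i
    consider "i < j" | "j \<le> i" "i \<le> n" | "n < i"
      by linarith
    then show "?\<sigma> (?\<sigma> i) = i"
    proof cases
      case 1
      then show ?thesis
        using low[of i] low[of "?\<sigma> i"] involutionsD(2)[OF inv] by simp
    next
      case 2
      then have "?\<sigma> (n + j - i) = i"
        using layer[of "n + j - i"] j by simp
      then show ?thesis
        using layer[OF 2] by simp
    next
      case 3
      then show ?thesis
        using high by simp
    qed
  next
    fix i
    assume "i \<notin> {1..n}"
    then show "?\<sigma> i = i"
      using high[of i] low(1)[of i] involution_outside[OF inv, of i] j by fastforce
  qed
  moreover have "\<not> contains_pattern n ?\<sigma> [3, 1, 2]"
  proof
    assume "contains_pattern n ?\<sigma> [3, 1, 2]"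
    then obtain a b c where abc: "1 \<le> a" "a < b" "b < c" "c \<le> n"
        "?\<sigma> b < ?\<sigma> c" "?\<sigma> c < ?\<sigma> a"
      unfolding contains_312_iff by blast
    have "b < j"
      using layer[of b] layer[of c] abc by (cases "b < j") auto
    then have "c < j"
      using low(2)[of a] layer[of c] abc by (cases "c < j") auto
    then have "contains_pattern (j - 1) \<tau> [3, 1, 2]"
      unfolding contains_312_iff using abc low(1)[of a] low(1)[of b] low(1)[of c]
      by (intro exI[of _ a] exI[of _ b] exI[of _ c]) simp
    with no312 show False
      by simp
  qed
  moreover have "\<not> contains_pattern n ?\<sigma> [4, 3, 2, 1]"
  proof
    assume "contains_pattern n ?\<sigma> [4, 3, 2, 1]"
    then obtain a b c d where abcd: "1 \<le> a" "a < b" "b < c" "c < d" "d \<le> n"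
        "?\<sigma> d < ?\<sigma> c" "?\<sigma> c < ?\<sigma> b" "?\<sigma> b < ?\<sigma> a"
      unfolding contains_4321_iff by blast
    have "a < j"
      using abcd j by linarith
    then have "d < j"
      using low(2)[of a] layer[of d] abcd by (cases "d < j") auto
    then have "contains_pattern (j - 1) \<tau> [4, 3, 2, 1]"
      unfolding contains_4321_iff
      using abcd low(1)[of a] low(1)[of b] low(1)[of c] low(1)[of d]
      by (intro exI[of _ a] exI[of _ b] exI[of _ c] exI[of _ d]) simp
    with no4321 show False
      by simp
  qed
  ultimately show ?thesis
    by (simp add: involutions_avoiding_def)
qed

text \<open>
  Let \<open>j = \<sigma> n\<close>, so that \<open>\<sigma> j = n\<close>. Between the positions \<open>j\<close> and \<open>n\<close>, no value lies below
  \<open>j\<close>, since it would form a 312 with the values \<open>n\<close> and \<open>j\<close>, and there is no ascent, since it would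
  form a 312 with the value \<open>n\<close>. Thus \<open>\<sigma>\<close> reverses this interval, and avoiding 4321 limits
  the interval to three points.
\<close>

lemma remove_last_layer:
  assumes \<sigma>: "\<sigma> \<in> involutions_avoiding n [4, 3, 2, 1] [3, 1, 2]"
    and n: "1 \<le> n"
  defines "j \<equiv> \<sigma> n"
  shows "1 \<le> j" "j \<le> n" "n \<le> j + 2"
    and "\<sigma> \<circ> transpose j n \<in> involutions_avoiding (j - 1) [4, 3, 2, 1] [3, 1, 2]"
proof -
  have inv: "\<sigma> \<in> involutions n"
    and no4321: "\<not> contains_pattern n \<sigma> [4, 3, 2, 1]"
    and no312: "\<not> contains_pattern n \<sigma> [3, 1, 2]"
    using \<sigma> by (auto simp: involutions_avoiding_def)
  note inj = involution_eq_iff[OF inv]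
  have \<sigma>n: "\<sigma> n = j" and \<sigma>j: "\<sigma> j = n"
    using involutionsD(2)[OF inv] by (auto simp: j_def)
  show j: "1 \<le> j" "j \<le> n"
    using involution_mem_iff[OF inv, of n] n by (auto simp: j_def)
  have mem: "1 \<le> \<sigma> i" "\<sigma> i \<le> n" if "1 \<le> i" "i \<le> n" for i
    using involution_mem_iff[OF inv, of i] that by auto
  have above: "j < \<sigma> i \<and> \<sigma> i < n" if "j < i" "i < n" for i
  proof -
    have "\<sigma> i \<noteq> j" "\<sigma> i \<noteq> n"
      using inj[of i n] inj[of i j] that \<sigma>n \<sigma>j by auto
    moreover have "\<not> \<sigma> i < j"
    proof
      assume "\<sigma> i < j"
      moreover have "j < n" "\<sigma> n < \<sigma> j"
        using that \<sigma>n \<sigma>j by auto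
      ultimately have "contains_pattern n \<sigma> [3, 1, 2]"
        unfolding contains_312_iff using that j \<sigma>n
        by (intro exI[of _ j] exI[of _ i] exI[of _ n]) simp
      with no312 show False
        by simp
    qed
    ultimately show ?thesis
      using mem[of i] that j by force
  qed
  show nj: "n \<le> j + 2"
  proof (rule ccontr)
    assume "\<not> n \<le> j + 2"
    then have lt: "j + 2 < n"
      by simp
    note mid = above[of "j + 1"] above[of "j + 2"]
    have "\<sigma> (j + 1) \<noteq> \<sigma> (j + 2)"
      using inj[of "j + 1" "j + 2"] by simp
    then consider "\<sigma> (j + 1) < \<sigma> (j + 2)" | "\<sigma> (j + 2) < \<sigma> (j + 1)"
      by linarith
    then show False
    proof cases
      case 1
      then have "contains_pattern n \<sigma> [3, 1, 2]"
        unfolding contains_312_iff using lt mid j \<sigma>j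
        by (intro exI[of _ j] exI[of _ "j + 1"] exI[of _ "j + 2"]) simp
      with no312 show False
        by simp
    next
      case 2
      then have "contains_pattern n \<sigma> [4, 3, 2, 1]"
        unfolding contains_4321_iff using lt mid j \<sigma>j \<sigma>n
        by (intro exI[of _ j] exI[of _ "j + 1"] exI[of _ "j + 2"] exI[of _ n]) simp
      with no4321 show False
        by simp
    qed
  qed
  let ?\<tau> = "\<sigma> \<circ> transpose j n"
  have low: "?\<tau> i = \<sigma> i" if "i < j" for i
    using that j by (simp add: transpose_def)
  have high: "?\<tau> i = i" if ji: "j \<le> i" for i
  proof -
    have "i = j \<or> i = n \<or> (j < i \<and> i < n) \<or> n < i"
      using ji by linarith
    then consider "i = j" | "i = n" | "j < i" "i < n" | "n < i"
      by blast
    then show ?thesis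
    proof cases
      case 3
      then have "i = j + 1" "n = j + 2"
        using nj by auto
      then show ?thesis
        using above[OF 3] by (simp add: transpose_def)
    next
      case 4
      then show ?thesis
        using involution_outside[OF inv, of i] j by (simp add: transpose_def)
    qed (use \<sigma>n \<sigma>j in \<open>auto simp: transpose_def\<close>)
  qed
  have "?\<tau> \<in> involutions (j - 1)"
  proof (rule involutionsI)
    fix i
    show "?\<tau> (?\<tau> i) = i"
    proof (cases "i < j")
      case True
      have "\<sigma> i \<noteq> j" "\<sigma> i \<noteq> n"
        using inj[of i n] inj[of i j] True j \<sigma>n \<sigma>j by auto
      then show ?thesis
        using True j involutionsD(2)[OF inv] by (simp add: transpose_def)
    qed (use high in simp)
  next
    fix i
    assume "i \<notin> {1..j - 1}"
    then show "?\<tau> i = i"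
      using high[of i] low[of i] involution_outside[OF inv, of i] by fastforce
  qed
  moreover have "\<not> contains_pattern (j - 1) ?\<tau> [3, 1, 2]"
  proof
    assume "contains_pattern (j - 1) ?\<tau> [3, 1, 2]"
    then obtain a b c where abc: "1 \<le> a" "a < b" "b < c" "c \<le> j - 1"
        "?\<tau> b < ?\<tau> c" "?\<tau> c < ?\<tau> a"
      unfolding contains_312_iff by blast
    then have "contains_pattern n \<sigma> [3, 1, 2]"
      unfolding contains_312_iff using low[of a] low[of b] low[of c] j
      by (intro exI[of _ a] exI[of _ b] exI[of _ c]) simp
    with no312 show False
      by simp
  qed
  moreover have "\<not> contains_pattern (j - 1) ?\<tau> [4, 3, 2, 1]"
  proof
    assume "contains_pattern (j - 1) ?\<tau> [4, 3, 2, 1]"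
    then obtain a b c d where abcd: "1 \<le> a" "a < b" "b < c" "c < d" "d \<le> j - 1"
        "?\<tau> d < ?\<tau> c" "?\<tau> c < ?\<tau> b" "?\<tau> b < ?\<tau> a"
      unfolding contains_4321_iff by blast
    then have "contains_pattern n \<sigma> [4, 3, 2, 1]"
      unfolding contains_4321_iff using low[of a] low[of b] low[of c] low[of d] j
      by (intro exI[of _ a] exI[of _ b] exI[of _ c] exI[of _ d]) simp
    with no4321 show False
      by simp
  qed
  ultimately show "?\<tau> \<in> involutions_avoiding (j - 1) [4, 3, 2, 1] [3, 1, 2]"
    by (simp add: involutions_avoiding_def)
qed

lemma involutions_avoiding_4321_312_by_last_layer:
  assumes "1 \<le> n"
  shows "involutions_avoiding n [4, 3, 2, 1] [3, 1, 2] =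
    (\<Union>j\<in>{max 1 (n - 2)..n}.
       (\<lambda>\<tau>. \<tau> \<circ> transpose j n) ` involutions_avoiding (j - 1) [4, 3, 2, 1] [3, 1, 2])"
    (is "?L = ?R")
proof
  show "?L \<subseteq> ?R"
  proof
    fix \<sigma>
    assume \<sigma>: "\<sigma> \<in> ?L"
    note r = remove_last_layer[OF \<sigma> assms]
    have "\<sigma> = (\<sigma> \<circ> transpose (\<sigma> n) n) \<circ> transpose (\<sigma> n) n"
      by (simp add: comp_assoc)
    then show "\<sigma> \<in> ?R"
      using r by (intro UN_I[of "\<sigma> n"] image_eqI[of _ _ "\<sigma> \<circ> transpose (\<sigma> n) n"]) auto
  qed
  show "?R \<subseteq> ?L"
    using append_layer by force
qed

text \<open>
  The pieces are disjoint because \<open>j\<close> is the value at \<open>n\<close>.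
\<close>

lemma card_involutions_avoiding_4321_312_rec:
  assumes "1 \<le> n"
  shows "card (involutions_avoiding n [4, 3, 2, 1] [3, 1, 2]) =
    (\<Sum>j\<in>{max 1 (n - 2)..n}. card (involutions_avoiding (j - 1) [4, 3, 2, 1] [3, 1, 2]))"
proof -
  let ?F = "\<lambda>j. (\<lambda>\<tau>. \<tau> \<circ> transpose j n) ` involutions_avoiding (j - 1) [4, 3, 2, 1] [3, 1, 2]"
  have last: "\<sigma> n = j" if "\<sigma> \<in> ?F j" "1 \<le> j" for \<sigma> j
  proof -
    from that(1) obtain \<tau> where \<tau>: "\<tau> \<in> involutions (j - 1)" "\<sigma> = \<tau> \<circ> transpose j n"
      by (auto simp: involutions_avoiding_def)
    then show ?thesis
      using involution_outside[of \<tau> "j - 1" j] that(2) by simp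
  qed
  have "card (\<Union>j\<in>{max 1 (n - 2)..n}. ?F j) = (\<Sum>j\<in>{max 1 (n - 2)..n}. card (?F j))"
  proof (rule card_UN_disjoint)
    show "\<forall>i\<in>{max 1 (n - 2)..n}. \<forall>j\<in>{max 1 (n - 2)..n}. i \<noteq> j \<longrightarrow> ?F i \<inter> ?F j = {}"
      using last by (metis (no_types, lifting) IntE atLeastAtMost_iff equals0I max.bounded_iff)
  qed (auto simp: finite_involutions_avoiding)
  moreover have "card (?F j) = card (involutions_avoiding (j - 1) [4, 3, 2, 1] [3, 1, 2])" for j
  proof (rule card_image, rule inj_onI)
    fix \<tau> \<tau>' :: "nat \<Rightarrow> nat"
    assume "\<tau> \<circ> transpose j n = \<tau>' \<circ> transpose j n"
    then have "\<tau> \<circ> transpose j n \<circ> transpose j n = \<tau>' \<circ> transpose j n \<circ> transpose j n"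
      by simp
    then show "\<tau> = \<tau>'"
      by (simp add: comp_assoc)
  qed
  ultimately show ?thesis
    unfolding involutions_avoiding_4321_312_by_last_layer[OF assms] by simp
qed

lemma card_involutions_avoiding_4321_312:
  "card (involutions_avoiding n [4, 3, 2, 1] [3, 1, 2]) = tribonacci (n + 2)"
proof (induction n rule: less_induct)
  case (less n)
  let ?c = "\<lambda>n. card (involutions_avoiding n [4, 3, 2, 1] [3, 1, 2])"
  have c0: "?c 0 = 1"
  proof -
    have "involutions_avoiding 0 [4, 3, 2, 1] [3, 1, 2] = {id}"
      unfolding involutions_avoiding_def involutions_0 contains_4321_iff contains_312_iff by auto
    then show ?thesis
      by simp
  qed
  consider "n = 0" | "n = 1" | "n = 2" | m where "n = Suc (Suc (Suc m))"
    by (metis One_nat_def Suc_1 not0_implies_Suc)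
  then show ?case
  proof cases
    case 1
    then show ?thesis
      using c0 by (simp add: numeral_2_eq_2)
  next
    case 2
    then show ?thesis
      using c0 card_involutions_avoiding_4321_312_rec[of 1] by (simp add: numeral_2_eq_2)
  next
    case 3
    moreover have "{max 1 (2 - 2)..2} = {1, 2 :: nat}"
      by auto
    ultimately show ?thesis
      using c0 card_involutions_avoiding_4321_312_rec[of 2] less.IH[of 1]
      by (simp add: eval_nat_numeral)
  next
    case 4
    then have "{max 1 (n - 2)..n} = {Suc m, Suc (Suc m), Suc (Suc (Suc m))}"
      by auto
    then have "?c n = ?c m + ?c (Suc m) + ?c (Suc (Suc m))"
      using card_involutions_avoiding_4321_312_rec[of n] 4 by simp
    then show ?thesis
      using 4 less.IH[of m] less.IH[of "Suc m"] less.IH[of "Suc (Suc m)"] by simp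
  qed
qed

section \<open>The five enumerations\<close>

lemma floor_half: "\<lfloor>real n / 2\<rfloor> = int (n div 2)"
  using floor_divide_of_nat_eq[of n 2] by simp

lemma ceiling_half: "\<lceil>real n / 2\<rceil> = int (Suc n div 2)"
  by (cases "even n") (auto elim!: evenE oddE intro: ceiling_unique)

theorem corollary6:
  fixes n :: nat
  assumes "n \<ge> 1"
  shows
    "int (card (involutions_avoiding n [4,3,2,1] [1,3,2])) = 1 + \<lfloor>real n / 2\<rfloor> * \<lceil>real n / 2\<rceil> \<and>
     int (card (involutions_avoiding n [4,3,2,1] [2,1,3])) = 1 + \<lfloor>real n / 2\<rfloor> * \<lceil>real n / 2\<rceil> \<and>
     card (involutions_avoiding n [4,3,2,1] [3,2,1]) = n choose (nat \<lfloor>real n / 2\<rfloor>) \<and>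
     involutions_avoiding n [4,3,2,1] [3,1,2] = involutions_avoiding n [4,3,2,1] [2,3,1] \<and>
     card (involutions_avoiding n [4,3,2,1] [3,1,2]) = tribonacci (n + 2)"
proof -
  have "involutions_avoiding n [4, 3, 2, 1] [3, 1, 2] = involutions_avoiding n [4, 3, 2, 1] [2, 3, 1]"
    unfolding involutions_avoiding_def using involution_contains_312_iff_231 by blast
  then show ?thesis
    unfolding floor_half ceiling_half card_involutions_avoiding_4321_213_eq_132
      card_involutions_avoiding_4321_132 card_involutions_avoiding_4321_321
      card_involutions_avoiding_4321_312
    by simp
qed

end
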